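(* Let $p,q$ be positive integers with $p<q$ and $2p>q$, and let $\mathcal{Q}=\{1,\ldots,p-1,p+1,\ldots,q\}$. For each $n\ge0$, the number of subsets of $\{1,\ldots,n\}$ such that no two elements of the subset differ by an element of $\mathcal{Q}$ equals the number of compositions of $n+q$ into parts drawn from the set $\{1\}\cup\{q+1+jp : j=0,1,2,\ldots\}$.
   Context: A composition of a positive integer is an expression of it as an ordered sum of positive integers (the parts); parts may be repeated. *)

theory Defs
  imports Main
begin

definition compositions :: "nat \<Rightarrow> nat list set" where
  "compositions n = {xs. (\<forall>x\<in>set xs. 0 < x) \<and> sum_list xs = n}"

definition compositions_with_parts_in :: "nat set \<Rightarrow> nat \<Rightarrow> nat list set" where
  "compositions_with_parts_in A n = {xs \<in> compositions n. set xs \<subseteq> A}"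

definition difference_avoiding :: "nat set \<Rightarrow> nat set \<Rightarrow> bool" where
  "difference_avoiding Q S \<longleftrightarrow> (\<forall>x\<in>S. \<forall>y\<in>S. x < y \<longrightarrow> y - x \<notin> Q)"

end

theory Submission
  imports Defs
begin

text \<open>
  The set of allowed differences is \<open>{p} \<union> {q+1, q+2, \<dots>}\<close>. Because \<open>2p > q\<close>, two successive
  gaps always add up to an allowed difference, so only the gaps between neighbouring elements of a
  set \<open>S\<close> matter: each is \<open>p\<close> or exceeds \<open>q\<close>. Hence \<open>S\<close> splits uniquely into maximal arithmetic
  progressions \<open>a, a + p, \<dots>, a + jp\<close>, and after the last element of each of them the next \<open>q\<close>
  positions are free. Let such a progression occupy all the positions \<open>a, \<dots>, a + jp + q\<close>; these
  are \<open>q + 1 + jp\<close> positions, and blocks of different progressions are disjoint. All blocks fit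
  into \<open>{1..n + q}\<close>, and the positions outside the blocks are filled with parts \<open>1\<close>. Reading
  off the lengths from left to right gives a composition of \<open>n + q\<close>, and the passage is reversible.

  The proof goes through the inverse map \<open>decode\<close>, which turns a composition into a set one part
  at a time, and shows that it is a bijection: it yields sets of the required kind
  (\<open>decode_subset\<close>, \<open>difference_avoiding_decode\<close>), it is injective because the set determines the
  first part (\<open>decode_first_part_unique\<close>), and it is surjective because every set has a first part
  that can be split off (\<open>leading_part_exists\<close>).
\<close>

locale gap_parameters =
  fixes p q :: nat
  assumes p_less_q: "p < q" and q_less_2p: "q < 2 * p"
begin

abbreviation forbidden :: "nat set" where
  "forbidden \<equiv> {1..p - 1} \<union> {p + 1..q}"

abbreviation parts :: "nat set" where
  "parts \<equiv> {1} \<union> {q + 1 + j * p | j. True}"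

text \<open>
  For the part \<open>x = q + 1 + jp\<close> this is the progression \<open>1, 1 + p, \<dots>, 1 + jp\<close>; bounding by \<open>x\<close>
  instead of by \<open>j\<close> makes it empty for the part \<open>1\<close>, so that no case distinction is necessary.
\<close>

definition progression :: "nat \<Rightarrow> nat set" where
  "progression x = {1 + i * p | i. i * p + q + 1 \<le> x}"

fun decode :: "nat list \<Rightarrow> nat set" where
  "decode [] = {}"
| "decode (x # xs) = progression x \<union> (\<lambda>y. y + x) ` decode xs"

lemma p_pos: "0 < p" and q_pos: "0 < q"
  using p_less_q q_less_2p by auto

lemma not_forbidden_iff:
  assumes "0 < d"
  shows "d \<notin> forbidden \<longleftrightarrow> d = p \<or> q < d"
  using assms p_less_q by auto

lemma difference_avoiding_iff:
  "difference_avoiding forbidden S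
     \<longleftrightarrow> (\<forall>x\<in>S. \<forall>y\<in>S. x < y \<longrightarrow> y - x = p \<or> q < y - x)"
  unfolding difference_avoiding_def
  by (intro ball_cong refl imp_cong) (rule not_forbidden_iff, simp)

lemma mem_compositions_parts_iff:
  "xs \<in> compositions_with_parts_in parts m \<longleftrightarrow> set xs \<subseteq> parts \<and> sum_list xs = m"
  by (auto simp: compositions_with_parts_in_def compositions_def)

section \<open>Compositions give difference-avoiding sets\<close>

lemma decode_pos: "y \<in> decode xs \<Longrightarrow> 0 < y"
  by (induction xs arbitrary: y) (auto simp: progression_def)

text \<open>The last \<open>q\<close> positions stay free because every progression ends \<open>q\<close> before its block does.\<close>

lemma decode_subset: "decode xs \<subseteq> {1..sum_list xs - q}"
proof (induction xs)
  case (Cons x xs)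
  show ?case
  proof
    fix y assume "y \<in> decode (x # xs)"
    then consider "y \<in> progression x" | z where "z \<in> decode xs" "y = z + x"
      by auto
    then show "y \<in> {1..sum_list (x # xs) - q}"
    proof cases
      case 1
      then show ?thesis by (auto simp: progression_def)
    next
      case 2
      with Cons.IH have "1 \<le> z" "z \<le> sum_list xs - q" by auto
      with 2 show ?thesis by auto
    qed
  qed
qed simp

text \<open>
  Within one progression, a difference that is not \<open>p\<close> is at least \<open>2p > q\<close>. An element of the
  first progression and a later one are more than \<open>q\<close> apart since the latter lies beyond the block.
\<close>

lemma difference_avoiding_decode: "difference_avoiding forbidden (decode xs)"
proof (induction xs)
  case Nil
  show ?case by (simp add: difference_avoiding_def)
next
  case (Cons x xs)
  show ?case
    unfolding difference_avoiding_iff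
  proof (intro ballI impI)
    fix u v assume u: "u \<in> decode (x # xs)" and v: "v \<in> decode (x # xs)" and "u < v"
    have beyond: "x < w" if "w \<in> (\<lambda>y. y + x) ` decode xs" for w
      using that by (auto dest: decode_pos)
    have within: "w + q \<le> x" if "w \<in> progression x" for w
      using that by (auto simp: progression_def)
    consider "u \<in> progression x" "v \<in> progression x"
      | "u \<in> progression x" "v \<in> (\<lambda>y. y + x) ` decode xs"
      | "u \<in> (\<lambda>y. y + x) ` decode xs" "v \<in> (\<lambda>y. y + x) ` decode xs"
      using u v \<open>u < v\<close> beyond within by fastforce
    then show "v - u = p \<or> q < v - u"
    proof cases
      case 1
      then obtain i k where uv: "u = 1 + i * p" "v = 1 + k * p"
        by (auto simp: progression_def)
      with \<open>u < v\<close> have "i < k" by simp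
      have diff: "v - u = (k - i) * p"
        using uv by (simp add: diff_mult_distrib)
      show ?thesis
      proof (cases "k - i = 1")
        case False
        with \<open>i < k\<close> have "2 * p \<le> (k - i) * p"
          by (intro mult_le_mono1) simp
        with diff q_less_2p show ?thesis by linarith
      qed (simp add: diff)
    next
      case 2
      with beyond within show ?thesis by fastforce
    next
      case 3
      then obtain a b where "a \<in> decode xs" "b \<in> decode xs" "u = a + x" "v = b + x"
        by blast
      with Cons.IH \<open>u < v\<close> show ?thesis
        unfolding difference_avoiding_iff by simp
    qed
  qed
qed

section \<open>The set determines the composition\<close>

text \<open>
  A longer first part puts an element into the set at a position that the block of the shorter
  first part covers but leaves empty.
\<close>

lemma decode_first_part_less:
  assumes "x \<in> parts" "y \<in> parts" "x < y"
  shows "decode (x # xs) \<noteq> decode (y # ys)"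
proof -
  have *: "w \<in> progression x" if "w \<in> decode (x # xs)" "w \<le> x" for w
    using that by (auto dest: decode_pos)
  from assms have "y \<noteq> 1" by auto
  with assms obtain j where y: "y = q + 1 + j * p" by auto
  from assms(1) consider "x = 1" | i where "x = q + 1 + i * p" by auto
  then show ?thesis
  proof cases
    case 1
    have "1 \<in> progression y"
      unfolding progression_def y by (intro CollectI exI[of _ 0]) simp
    then have "1 \<in> decode (y # ys)" by simp
    moreover have "1 \<notin> decode (x # xs)"
      using *[of 1] 1 q_pos by (auto simp: progression_def)
    ultimately show ?thesis by blast
  next
    case 2
    \<comment> \<open>Since \<open>p \<le> q\<close>, the element following the shorter progression still lies in its block.\<close>
    let ?w = "1 + Suc i * p"
    from 2 y assms(3) have "i < j" by simp
    then have "Suc i * p \<le> j * p" by (intro mult_le_mono1) simp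
    then have "?w \<in> progression y"
      unfolding progression_def y by (intro CollectI exI[of _ "Suc i"]) auto
    then have "?w \<in> decode (y # ys)" unfolding decode.simps by (rule UnI1)
    moreover have "?w \<notin> progression x"
    proof
      assume "?w \<in> progression x"
      then obtain l where "?w = 1 + l * p" "l * p + q + 1 \<le> x"
        unfolding progression_def by blast
      then have "Suc i * p + q + 1 \<le> x" by linarith
      with 2 p_pos show False by simp
    qed
    moreover have "?w \<le> x" using 2 p_less_q by simp
    ultimately show ?thesis using * by metis
  qed
qed

lemma decode_first_part_unique:
  assumes "x \<in> parts" "y \<in> parts" "decode (x # xs) = decode (y # ys)"
  shows "x = y"
  using decode_first_part_less[of x y xs ys] decode_first_part_less[of y x ys xs] assms
  by (metis linorder_neqE_nat)

text \<open>
  The tail occupies the positions beyond the first part, so it is recovered by forgetting the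
  positions in the first block.
\<close>

lemma decode_Cons_cancel:
  assumes "decode (x # xs) = decode (x # ys)"
  shows "decode xs = decode ys"
proof -
  have beyond: "decode (x # zs) \<inter> {x<..} = (\<lambda>y. y + x) ` decode zs" for zs
    by (auto simp: progression_def dest: decode_pos)
  have "(\<lambda>y. y + x) ` decode xs = (\<lambda>y. y + x) ` decode ys"
    using beyond[of xs] beyond[of ys] assms by metis
  then show ?thesis by (simp add: inj_image_eq_iff)
qed

lemma decode_inj:
  assumes "set xs \<subseteq> parts" "set ys \<subseteq> parts" "sum_list xs = sum_list ys"
    and "decode xs = decode ys"
  shows "xs = ys"
  using assms
proof (induction xs arbitrary: ys)
  case Nil
  then show ?case by (cases ys) auto
next
  case (Cons x xs)
  then obtain y ys' where ys: "ys = y # ys'" by (cases ys) auto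
  have "x \<in> parts" "y \<in> parts"
    using Cons.prems ys by (meson list.set_intros(1) subsetD)+
  with Cons.prems ys have "x = y"
    using decode_first_part_unique by blast
  moreover have "decode xs = decode ys'"
    using Cons.prems(4) ys \<open>x = y\<close> decode_Cons_cancel by blast
  ultimately show ?case
    using Cons.IH[of ys'] Cons.prems ys by simp
qed

section \<open>Every difference-avoiding set arises\<close>

text \<open>
  If \<open>1 \<notin> S\<close>, the first part is \<open>1\<close>. Otherwise it comes from the longest progression
  \<open>1, 1 + p, \<dots>, 1 + jp\<close> inside \<open>S\<close>: an element of \<open>S\<close> off this progression cannot be less than \<open>p\<close>
  above one of its elements, nor exactly \<open>p\<close> above the last one by maximality, so that it is more
  than \<open>q\<close> above the last one.
\<close>

lemma leading_part_exists:
  assumes avoid: "difference_avoiding forbidden S" and S: "S \<subseteq> {1..m - q}" and "0 < m"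
  obtains x where "x \<in> parts" "x \<le> m" "progression x \<subseteq> S"
    and "\<And>y. y \<in> S \<Longrightarrow> y \<le> x \<Longrightarrow> y \<in> progression x"
proof (cases "1 \<in> S")
  case False
  have "y \<notin> S" if "y \<le> 1" for y
    using that S False by (cases "y = 0") (auto simp: le_Suc_eq)
  with q_pos \<open>0 < m\<close> show ?thesis
    by (intro that[of 1]) (auto simp: progression_def)
next
  case True
  define k where "k = (LEAST k. 1 + k * p \<notin> S)"
  have "m \<le> m * p" using p_pos by simp
  then have "1 + m * p \<notin> {1..m - q}" by (simp only: atLeastAtMost_iff) linarith
  with S have "1 + m * p \<notin> S" by blast
  then have k_notin: "1 + k * p \<notin> S" unfolding k_def by (rule LeastI)
  have below_k: "1 + i * p \<in> S" if "i < k" for i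
    using that not_less_Least unfolding k_def by blast
  from k_notin True have "k \<noteq> 0" by (metis add.right_neutral mult_0)
  then obtain j where k: "k = Suc j" by (cases k) auto
  have mem: "1 + i * p \<in> S" if "i \<le> j" for i using that below_k k by simp
  let ?x = "q + 1 + j * p"
  show ?thesis
  proof (rule that[of ?x])
    show "?x \<in> parts" by auto
    show "?x \<le> m" using mem[of j] S by fastforce
    show "progression ?x \<subseteq> S"
      using mem p_pos by (auto simp: progression_def)
    fix y assume y: "y \<in> S" "y \<le> ?x"
    define i where "i = (y - 1) div p"
    have "1 \<le> y" using y(1) S by auto
    then have decomp: "y = 1 + i * p + (y - 1) mod p"
      by (simp add: i_def)
    show "y \<in> progression ?x"
    proof (cases "i \<le> j")
      case True
      have "y = 1 + i * p"
      proof (rule ccontr)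
        assume "y \<noteq> 1 + i * p"
        with decomp have "1 + i * p < y" by linarith
        with avoid mem[OF True] y(1) have "y - (1 + i * p) = p \<or> q < y - (1 + i * p)"
          unfolding difference_avoiding_iff by blast
        moreover have "y - (1 + i * p) < p"
          using decomp p_pos by (metis add_diff_cancel_left' mod_less_divisor)
        ultimately show False using p_less_q by linarith
      qed
      moreover have "i * p \<le> j * p" using True by simp
      ultimately show ?thesis by (auto simp: progression_def)
    next
      case False
      then have "k * p \<le> i * p" using k by (intro mult_le_mono1) simp
      with decomp have "1 + k * p \<le> y" by linarith
      moreover have "y \<noteq> 1 + k * p" using y(1) k_notin by auto
      ultimately have beyond: "1 + j * p + p < y" using k by simp
      with avoid mem[of j] y(1) have "y - (1 + j * p) = p \<or> q < y - (1 + j * p)"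
        unfolding difference_avoiding_iff by force
      with beyond y(2) show ?thesis by linarith
    qed
  qed
qed

lemma decode_surj:
  assumes "difference_avoiding forbidden S" "S \<subseteq> {1..m - q}"
  shows "\<exists>xs. set xs \<subseteq> parts \<and> sum_list xs = m \<and> decode xs = S"
  using assms
proof (induction m arbitrary: S rule: less_induct)
  case (less m)
  show ?case
  proof (cases "m = 0")
    case True
    with less.prems show ?thesis by (intro exI[of _ "[]"]) auto
  next
    case False
    then obtain x where x: "x \<in> parts" "x \<le> m" "progression x \<subseteq> S"
      and initial: "\<And>y. y \<in> S \<Longrightarrow> y \<le> x \<Longrightarrow> y \<in> progression x"
      using leading_part_exists[OF less.prems] by blast
    define T where "T = {z. 0 < z \<and> z + x \<in> S}"
    from x(1) have "0 < x" by auto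
    have "difference_avoiding forbidden T"
      using less.prems(1) unfolding difference_avoiding_iff T_def by fastforce
    moreover have "T \<subseteq> {1..m - x - q}"
      using less.prems(2) by (fastforce simp: T_def)
    moreover have "m - x < m" using \<open>0 < x\<close> False by simp
    ultimately obtain xs where xs: "set xs \<subseteq> parts" "sum_list xs = m - x" "decode xs = T"
      using less.IH by blast
    have "y \<in> progression x \<union> (\<lambda>z. z + x) ` T" if "y \<in> S" for y
    proof (cases "y \<le> x")
      case False
      with that have "y = (y - x) + x" "y - x \<in> T" by (auto simp: T_def)
      then show ?thesis by blast
    qed (use initial that in blast)
    then have "decode (x # xs) = S"
      using x(3) xs(3) by (auto simp: T_def)
    then show ?thesis using x xs by (intro exI[of _ "x # xs"]) auto
  qed
qed

lemma bij_betw_decode: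
  "bij_betw decode (compositions_with_parts_in parts m)
     {S. S \<subseteq> {1..m - q} \<and> difference_avoiding forbidden S}"
proof (rule bij_betwI')
  fix xs ys
  assume "xs \<in> compositions_with_parts_in parts m" "ys \<in> compositions_with_parts_in parts m"
  then show "decode xs = decode ys \<longleftrightarrow> xs = ys"
    unfolding mem_compositions_parts_iff using decode_inj by blast
next
  fix xs assume "xs \<in> compositions_with_parts_in parts m"
  then have "sum_list xs = m"
    by (simp only: mem_compositions_parts_iff)
  then show "decode xs \<in> {S. S \<subseteq> {1..m - q} \<and> difference_avoiding forbidden S}"
    using decode_subset[of xs] difference_avoiding_decode[of xs] by blast
next
  fix S assume "S \<in> {S. S \<subseteq> {1..m - q} \<and> difference_avoiding forbidden S}"
  then show "\<exists>xs\<in>compositions_with_parts_in parts m. S = decode xs"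
    using decode_surj[of S m] unfolding Bex_def mem_compositions_parts_iff by blast
qed

end

theorem theorem19:
  fixes p q n :: nat and Q :: "nat set"
  assumes "0 < p" and "0 < q" and "p < q" and "q < 2 * p"
    and "Q = {1..p - 1} \<union> {p + 1..q}"
  shows "card {S. S \<subseteq> {1..n} \<and> difference_avoiding Q S}
       = card (compositions_with_parts_in ({1} \<union> {q + 1 + j * p | j. True}) (n + q))"
proof -
  interpret gap_parameters p q
    using assms(3,4) by unfold_locales
  show ?thesis
    using bij_betw_same_card[OF bij_betw_decode[of "n + q"]] assms(5) by simp
qed

end
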